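(* Let $p$ be a prime. (a) If $p\equiv 1\pmod 4$, then \[ \sum_{j=1}^{p-1} r_2(j)\left( \sigma^{\ast}(p-j)- 4\sigma^{\ast}\!\left(\tfrac{p-j}{2}\right) \right)= p-1. \] (b) If $p\equiv 3\pmod 4$, then \[ \sum_{j=1}^{p-1} r_2(j)\left( \sigma^{\ast}(p-j)-4\sigma^{\ast}\!\left(\tfrac{p-j}{2}\right) \right)= -p -1. \]
   Context: $r_2(n)=\#\{(x_1,x_2)\in\mathbb{Z}^2 : n=x_1^2+x_2^2\}$. The function $\sigma^{\ast}$ is defined on $\mathbb{Q}$ by $\sigma^{\ast}(q)=0$ if $q\notin\mathbb{N}=\{1,2,\dots\}$, and $\sigma^{\ast}(q)=\sum_{d\mid q,\ q/d\text{ odd}} d$ for $q\in\mathbb{N}$. *)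

theory Defs
  imports Complex_Main "HOL-Number_Theory.Number_Theory"
begin

definition r2 :: "nat \<Rightarrow> nat" where
  "r2 n = card {(x1 :: int, x2 :: int). int n = x1\<^sup>2 + x2\<^sup>2}"

text \<open>The library's \<open>\<nat>\<close> contains 0, whereas \<open>sigma_star\<close> is supported on the positive
  integers only. For such \<open>q\<close>, \<open>nat \<lfloor>q\<rfloor>\<close> is \<open>q\<close> itself viewed as a natural number.\<close>

definition sigma_star :: "rat \<Rightarrow> int" where
  "sigma_star q =
    (if q \<in> \<nat> - {0}
     then (\<Sum>d | d dvd nat \<lfloor>q\<rfloor> \<and> odd (nat \<lfloor>q\<rfloor> div d). int d)
     else 0)"

end

theory Submission
  imports Defs
begin

text \<open>
  With $s(m)$ the sum of the divisors of $m$ with odd codivisor, the weight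
  $\sigma^*(m) - 4\sigma^*(m/2)$ equals $f(m) = -(-1)^m s(m)$. A Liouville-type argument gives
  $\sum_{k^2 < n} f(n - k^2) = n$ if $n > 0$ is a square and $0$ otherwise; in terms of generating
  functions, with $F = \sum_m f(m) q^m$, this is $q\,\theta' = 2 F \theta$.
  Summing over a second square (that is, multiplying by $\theta$) yields $4 \sum_{j < n} r_2(j) f(n - j) = n\, r_2(n)$. For a prime $p$ the term
  $j = 0$ contributes $f(p) = p + 1$, and $r_2(p)$ is $8$ or $0$ according to $p$ modulo $4$.
\<close>

section \<open>Signed divisor sums\<close>

definition sg :: "int \<Rightarrow> int" where
  "sg k = (if even k then 1 else - 1)"

lemma sg_minus [simp]: "sg (- k) = sg k"
  by (simp add: sg_def)

definition odd_codivisor_sum :: "nat \<Rightarrow> int" where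
  "odd_codivisor_sum m = (\<Sum>d | d dvd m \<and> odd (m div d). int d)"

text \<open>The weight f of the overview. With theta the sum of q^(k^2) over all integers k, its
  generating function is half the logarithmic derivative q theta'/theta.\<close>

definition alt_sum :: "nat \<Rightarrow> int" where
  "alt_sum m = - sg (int m) * odd_codivisor_sum m"

section \<open>Liouville-type cancellation over triples\<close>

lemma sum_involution_zero:
  fixes g :: "'a \<Rightarrow> int"
  assumes "\<And>x. x \<in> A \<Longrightarrow> i x \<in> A" "\<And>x. x \<in> A \<Longrightarrow> i (i x) = x"
    and "\<And>x. x \<in> A \<Longrightarrow> g (i x) = - g x"
  shows "sum g A = 0"
proof -
  \<comment> \<open>Fixed points of \<open>i\<close> do no harm: there \<open>g x = - g x\<close>,
    so they contribute 0.\<close>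
  have "sum g A = (\<Sum>x\<in>A. - g x)"
    by (rule sum.reindex_bij_witness[of _ i i]) (use assms in auto)
  then show ?thesis by (simp add: sum_negf)
qed

text \<open>A triple records a factorization of n - k^2 into a divisor \<open>d\<close> and its odd
  codivisor \<open>e\<close>. Keeping \<open>e\<close> as a coordinate makes the substitutions below
  linear.\<close>

definition triples :: "int \<Rightarrow> (int \<times> int \<times> int) set" where
  "triples n = {(k, d, e). k\<^sup>2 + d * e = n \<and> 0 < d \<and> 0 < e \<and> odd e}"

lemma abs_le_square_int: "\<bar>k\<bar> \<le> (k::int)\<^sup>2"
proof (cases "k = 0")
  case False
  then have "\<bar>k\<bar> * 1 \<le> \<bar>k\<bar> * \<bar>k\<bar>" by (intro mult_left_mono) auto
  then show ?thesis by (simp add: power2_eq_square)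
qed simp

lemma finite_triples: "finite (triples n)"
proof -
  have "triples n \<subseteq> {-n..n} \<times> {0..n} \<times> {0..n}"
  proof
    fix t assume "t \<in> triples n"
    then obtain k d e where t: "t = (k, d, e)" and h: "k\<^sup>2 + d * e = n" "0 < d" "0 < e" by (auto simp: triples_def)
    have "d * 1 \<le> d * e" "1 * e \<le> d * e" using h by (auto intro: mult_left_mono mult_right_mono)
    then have "-n \<le> k \<and> k \<le> n \<and> d \<le> n \<and> e \<le> n"
      using h abs_le_square_int[of k] zero_le_power2[of k] by linarith
    then show "t \<in> {-n..n} \<times> {0..n} \<times> {0..n}" using t h by simp
  qed
  then show ?thesis by (rule finite_subset) auto
qed

text \<open>
  The sum of $(-1)^k d$ over \<open>triples n\<close> equals that of $(-1)^k (d + k)$ by the symmetry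
  $k \mapsto -k$. The latter weight is negated by $(k, d, e) \mapsto (e - k, d + 2k - e, e)$
  where this is defined, that is, for $e < d + 2k$.
\<close>

lemma triples_sum_above:
  "(\<Sum>(k, d, e) \<in> {(k, d, e) \<in> triples n. e < d + 2 * k}. sg k * (d + k)) = 0"
  by (rule sum_involution_zero[where i = "\<lambda>(k, d, e). (e - k, d + 2 * k - e, e)"])
     (auto simp: triples_def sg_def power2_eq_square algebra_simps)

text \<open>
  Substituting $x = k + d$, $y = d$, $z = e - 2k - d$ turns the weight into $(-1)^{x-y} x$ with
  $y + z$ odd and $y - z < 2x$. Exchanging $y$ and $z$ cancels the terms with $2x > |y - z|$,
  and $x \mapsto -x$ the others.
\<close>

lemma triples_sum_below:
  "(\<Sum>(k, d, e) \<in> {(k, d, e) \<in> triples n. e > d + 2 * k}. sg k * (d + k)) = 0"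
proof -
  define C where "C = {(x, y, z). x\<^sup>2 + y * z = n \<and> 0 < y \<and> 0 < z \<and> odd (y + z) \<and> y - z < 2 * x}"
  have "(\<Sum>(k, d, e) \<in> {(k, d, e) \<in> triples n. e > d + 2 * k}. sg k * (d + k))
      = (\<Sum>(x, y, z) \<in> C. sg (x - y) * x)"
    by (rule sum.reindex_bij_witness[of _ "\<lambda>(x, y, z). (x - y, y, z + 2 * x - y)"
          "\<lambda>(k, d, e). (k + d, d, e - 2 * k - d)"])
       (auto simp: triples_def C_def power2_eq_square algebra_simps)
  also have "\<dots> = 0"
  proof (rule sum_involution_zero[where
        i = "\<lambda>(x, y, z). if z - y < 2 * x then (x, z, y) else (- x, y, z)"])
    fix t assume t: "t \<in> C"
    obtain x y z where xyz: "t = (x, y, z)" by (cases t)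
    \<comment> \<open>Parity makes the second branch strict: there 2x < z - y, which is exactly
      membership of (-x, y, z) in \<open>C\<close>. Conversely y - z < 2x keeps that image in the
      second branch, so the map is an involution.\<close>
    have "2 * x \<noteq> z - y"
    proof
      assume "2 * x = z - y"
      then have "y + z = 2 * (x + y)" by simp
      then show False using t xyz by (simp add: C_def)
    qed
    then show "(case t of (x, y, z) \<Rightarrow> if z - y < 2 * x then (x, z, y) else (- x, y, z)) \<in> C"
      using t xyz by (auto simp: C_def algebra_simps)
    show "(case case t of (x, y, z) \<Rightarrow> if z - y < 2 * x then (x, z, y) else (- x, y, z) of
        (x, y, z) \<Rightarrow> if z - y < 2 * x then (x, z, y) else (- x, y, z)) = t"
      using t xyz \<open>2 * x \<noteq> z - y\<close> by (auto simp: C_def)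
    show "(case case t of (x, y, z) \<Rightarrow> if z - y < 2 * x then (x, z, y) else (- x, y, z) of
        (x, y, z) \<Rightarrow> sg (x - y) * x) = - (case t of (x, y, z) \<Rightarrow> sg (x - y) * x)"
      using t xyz by (auto simp: C_def sg_def)
  qed
  finally show ?thesis .
qed

text \<open>On the boundary e = d + 2k the form k^2 + de is the square (k + d)^2, so k + d = m. What
  remains free is an odd \<open>d\<close> with 0 < d < 2m: there are m choices, each of weight
  (-1)^(m-d) m = -(-1)^m m.\<close>

lemma triples_sum_on_square:
  assumes "0 < m"
  shows "(\<Sum>(k, d, e) \<in> {(k, d, e) \<in> triples (m\<^sup>2). e = d + 2 * k}. sg k * (d + k)) = - sg m * m\<^sup>2"
proof -
  have *: "k + d = m" if "k\<^sup>2 + d * (d + 2 * k) = m\<^sup>2" "0 < d" "0 < d + 2 * k" for k d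
  proof -
    have "(k + d)\<^sup>2 = m\<^sup>2" using that by (simp add: power2_eq_square algebra_simps)
    \<comment> \<open>The two positivity conditions add up to 2(k + d) > 0, which excludes the root
      -m.\<close>
    then show ?thesis using assms that by (auto simp: power2_eq_iff)
  qed
  define h where "h i = (m - (2 * i + 1), 2 * i + 1, 2 * m - (2 * i + 1))" for i
  have "{(k, d, e) \<in> triples (m\<^sup>2). e = d + 2 * k} = h ` {0..<m}"
  proof (intro equalityI subsetI; clarify)
    fix k d assume t: "(k, d, d + 2 * k) \<in> triples (m\<^sup>2)"
    then have "k + d = m" by (intro *) (auto simp: triples_def)
    moreover obtain i where "d = 2 * i + 1" using t by (auto simp: triples_def elim: oddE)
    ultimately show "(k, d, d + 2 * k) \<in> h ` {0..<m}"
      using t by (intro image_eqI[of _ _ i]) (auto simp: h_def triples_def)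
  next
    fix k d e i assume "(k, d, e) = h i" "i \<in> {0..<m}"
    then have "k = m - (2 * i + 1)" "d = 2 * i + 1" "e = 2 * m - (2 * i + 1)" "0 \<le> i" "i < m"
      by (simp_all add: h_def)
    moreover from this have "k = m - d" "e = 2 * m - d" by simp_all
    then have "k\<^sup>2 + d * e = m\<^sup>2"
      by (simp only:) (simp add: power2_eq_square algebra_simps)
    ultimately show "(k, d, e) \<in> triples (m\<^sup>2) \<and> e = d + 2 * k"
      by (simp add: triples_def)
  qed
  moreover have "inj_on h {0..<m}" by (rule inj_onI) (simp add: h_def)
  ultimately have "(\<Sum>(k, d, e) \<in> {(k, d, e) \<in> triples (m\<^sup>2). e = d + 2 * k}. sg k * (d + k))
      = (\<Sum>i\<in>{0..<m}. case h i of (k, d, e) \<Rightarrow> sg k * (d + k))"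
    by (simp only: sum.reindex o_def)
  also have "\<dots> = (\<Sum>i\<in>{0..<m}. - sg m * m)"
    by (simp add: h_def sg_def)
  also have "\<dots> = - sg m * m\<^sup>2" using assms by (simp add: power2_eq_square)
  finally show ?thesis .
qed

lemma triples_sum_on_nonsquare:
  assumes "\<nexists>m. n = m\<^sup>2"
  shows "{(k, d, e) \<in> triples n. e = d + 2 * k} = {}"
proof -
  have False if "k\<^sup>2 + d * (d + 2 * k) = n" for k d
  proof -
    have "n = (k + d)\<^sup>2" using that by (simp add: power2_eq_square algebra_simps)
    then show False using assms by blast
  qed
  then show ?thesis by (auto simp: triples_def)
qed

text \<open>The added term (-1)^k k is odd in k and sums to 0. Of the three regions given by
  comparing \<open>e\<close> with \<open>d + 2 * k\<close>, only the boundary survives the two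
  cancellations.\<close>

lemma triples_sum:
  "(\<Sum>(k, d, e) \<in> triples n. sg k * d)
     = (\<Sum>(k, d, e) \<in> {(k, d, e) \<in> triples n. e = d + 2 * k}. sg k * (d + k))"
proof -
  let ?g = "\<lambda>(k, d, e::int). sg k * (d + k)"
  let ?A = "{(k, d, e) \<in> triples n. e < d + 2 * k}"
  let ?B = "{(k, d, e) \<in> triples n. e = d + 2 * k}"
  let ?C = "{(k, d, e) \<in> triples n. e > d + 2 * k}"
  have "(\<Sum>(k, d, e) \<in> triples n. sg k * k) = 0"
    by (rule sum_involution_zero[where i = "\<lambda>(k, d, e). (- k, d, e)"])
       (auto simp: triples_def)
  then have "(\<Sum>(k, d, e) \<in> triples n. sg k * d) = sum ?g (triples n)"
    by (simp add: case_prod_unfold sum.distrib distrib_left)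
  also have "\<dots> = sum ?g (?A \<union> (?B \<union> ?C))" by (rule arg_cong[of _ _ "sum ?g"]) auto
  also have "\<dots> = sum ?g ?A + (sum ?g ?B + sum ?g ?C)"
  proof (subst sum.union_disjoint)
    show "sum ?g ?A + sum ?g (?B \<union> ?C) = sum ?g ?A + (sum ?g ?B + sum ?g ?C)"
      by (subst sum.union_disjoint) (auto intro: finite_subset[OF _ finite_triples[of n]])
  qed (auto intro: finite_subset[OF _ finite_triples[of n]])
  finally show ?thesis using triples_sum_above triples_sum_below by simp
qed

section \<open>The recurrence for \<open>alt_sum\<close> along squares\<close>

lemma finite_square_less: "finite {k::int. k\<^sup>2 < n}"
proof (rule finite_subset)
  show "{k. k\<^sup>2 < n} \<subseteq> {-n..n}"
  proof
    fix k assume "k \<in> {k. k\<^sup>2 < n}"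
    then show "k \<in> {-n..n}" using abs_le_square_int[of k] by auto
  qed
qed simp

text \<open>Since k^2 and k have the same parity, the sign of n - k^2 factors as (-1)^n (-1)^k. A
  pair of k and a divisor d of n - k^2 with odd codivisor then becomes a triple by adjoining that
  codivisor.\<close>

lemma triples_sum_eq_alt_sum:
  "(\<Sum>k | k\<^sup>2 < int n. alt_sum (nat (int n - k\<^sup>2)))
     = - sg (int n) * (\<Sum>(k, d, e) \<in> triples (int n). sg k * d)"
proof -
  define D where "D k = {d. d dvd nat (int n - k\<^sup>2) \<and> odd (nat (int n - k\<^sup>2) div d)}" for k :: int
  have fin: "finite (D k)" if "k\<^sup>2 < int n" for k
    using that unfolding D_def by (intro finite_subset[OF _ finite_divisors_nat]) auto
  have sg: "sg (int (nat (int n - k\<^sup>2))) = sg (int n) * sg k" if "k\<^sup>2 < int n" for k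
    using that by (auto simp: sg_def)
  have "(\<Sum>k | k\<^sup>2 < int n. alt_sum (nat (int n - k\<^sup>2)))
      = (\<Sum>k | k\<^sup>2 < int n. \<Sum>d\<in>D k. - sg (int n) * (sg k * int d))"
    by (rule sum.cong)
       (simp_all only: alt_sum_def odd_codivisor_sum_def D_def sg sum_distrib_left mult.assoc
          mem_Collect_eq mult_minus_left)
  also have "\<dots> = (\<Sum>(k, d) \<in> Sigma {k. k\<^sup>2 < int n} D. - sg (int n) * (sg k * int d))"
    by (rule sum.Sigma) (use fin finite_square_less in auto)
  also have "\<dots> = (\<Sum>(k, d, e) \<in> triples (int n). - sg (int n) * (sg k * d))"
  proof (rule sum.reindex_bij_witness[of _ "\<lambda>(k, d, e). (k, nat d)"
        "\<lambda>(k, d). (k, int d, int (nat (int n - k\<^sup>2) div d))"], goal_cases)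
    case (1 a)
    then show ?case by (auto simp: split: prod.splits)
  next
    case (2 a)
    obtain k d where a: "a = (k, d)" by (cases a)
    define m where "m = nat (int n - k\<^sup>2)"
    have m: "int m = int n - k\<^sup>2" "0 < m" using 2 a by (auto simp: m_def)
    have d: "d dvd m" "odd (m div d)" using 2 a by (auto simp: D_def m_def)
    then have "d * (m div d) = m" by simp
    then have "int d * int (m div d) = int m" by (metis of_nat_mult)
    moreover have "0 < d" "0 < m div d" using d m by (auto intro: dvd_pos_nat simp: dvd_imp_le odd_pos)
    ultimately show ?case using a d m by (auto simp: triples_def m_def[symmetric])
  next
    case (3 b)
    obtain k d e where b: "b = (k, d, e)" by (cases b)
    have h: "k\<^sup>2 + d * e = int n" "0 < d" "0 < e" "odd e" using 3 b by (auto simp: triples_def)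
    then have nat: "nat (int n - k\<^sup>2) = nat d * nat e" by (simp add: nat_mult_distrib flip: h(1))
    show ?case using b h(2,3) by (simp add: nat)
  next
    case (4 b)
    obtain k d e where b: "b = (k, d, e)" by (cases b)
    have h: "k\<^sup>2 + d * e = int n" "0 < d" "0 < e" "odd e" using 4 b by (auto simp: triples_def)
    then have "nat (int n - k\<^sup>2) = nat d * nat e" by (simp add: nat_mult_distrib flip: h(1))
    moreover have "odd (nat e)" using h by (simp add: even_nat_iff)
    moreover have "k\<^sup>2 < int n" using h(2,3) by (simp flip: h(1))
    ultimately show ?case using b h(2,3) by (simp add: D_def)
  next
    case (5 a)
    then show ?case by (auto split: prod.splits)
  qed
  also have "\<dots> = - sg (int n) * (\<Sum>(k, d, e) \<in> triples (int n). sg k * d)"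
    by (simp add: sum_distrib_left case_prod_unfold)
  finally show ?thesis .
qed

lemma alt_sum_recurrence_square:
  assumes "0 < m" "int n = m\<^sup>2"
  shows "(\<Sum>k | k\<^sup>2 < int n. alt_sum (nat (int n - k\<^sup>2))) = int n"
proof -
  have "sg (int n) = sg m" using assms by (simp add: sg_def)
  then show ?thesis
    unfolding triples_sum_eq_alt_sum triples_sum
    using triples_sum_on_square[OF assms(1)] assms(2) by (simp add: sg_def)
qed

lemma alt_sum_recurrence_nonsquare:
  assumes "\<nexists>m. int n = m\<^sup>2"
  shows "(\<Sum>k | k\<^sup>2 < int n. alt_sum (nat (int n - k\<^sup>2))) = 0"
  by (simp add: triples_sum_eq_alt_sum triples_sum triples_sum_on_nonsquare[OF assms])

text \<open>This unites the square and nonsquare cases: a positive square n has two roots, each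
  contributing n on the right. It is the coefficient of q^n in q theta' = 2 F theta, in a form that
  can be summed over a second square.\<close>

lemma alt_sum_recurrence:
  assumes "0 < n"
  shows "2 * (\<Sum>k | k\<^sup>2 < int n. alt_sum (nat (int n - k\<^sup>2))) = (\<Sum>k | k\<^sup>2 = int n. k\<^sup>2)"
proof (cases "\<exists>m. int n = m\<^sup>2")
  case True
  then obtain m where "int n = m\<^sup>2" by blast
  then have m: "int n = \<bar>m\<bar>\<^sup>2" by simp
  with assms have "0 < \<bar>m\<bar>" by auto
  have "{k. k\<^sup>2 = int n} = {\<bar>m\<bar>, - \<bar>m\<bar>}" unfolding m power2_eq_iff by auto
  then have "(\<Sum>k | k\<^sup>2 = int n. k\<^sup>2) = 2 * int n"
    using \<open>0 < \<bar>m\<bar>\<close> m by simp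
  then show ?thesis
    by (simp only: alt_sum_recurrence_square[OF \<open>0 < \<bar>m\<bar>\<close> m])
next
  case False
  then have "{k. k\<^sup>2 = int n} = {}" unfolding eq_commute[of _ "int n"] by simp
  then show ?thesis by (simp only: alt_sum_recurrence_nonsquare[OF False] sum.empty mult_zero_right)
qed

section \<open>Convolution with \<open>r2\<close>\<close>

lemma finite_two_square_reps: "finite {(x::int, y::int). x\<^sup>2 + y\<^sup>2 \<le> n}"
proof (rule finite_subset)
  show "{(x, y). x\<^sup>2 + y\<^sup>2 \<le> n} \<subseteq> {-n..n} \<times> {-n..n}"
  proof clarify
    fix x y :: int assume "x\<^sup>2 + y\<^sup>2 \<le> n"
    moreover have "0 \<le> x\<^sup>2" "0 \<le> y\<^sup>2" by simp_all
    ultimately show "x \<in> {-n..n} \<and> y \<in> {-n..n}"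
      using abs_le_square_int[of x] abs_le_square_int[of y] unfolding atLeastAtMost_iff by linarith
  qed
qed simp

text \<open>Expanding \<open>r2 j\<close> gives a sum over the lattice points with x^2 + y^2 < n.
  For fixed x, the recurrence at n - x^2 evaluates the sum over y, leaving the sum of y^2 over the
  circle x^2 + y^2 = n.\<close>

lemma r2_alt_sum_convolution:
  "4 * (\<Sum>j<n. int (r2 j) * alt_sum (n - j)) = int n * int (r2 n)"
proof -
  define f where "f x y = alt_sum (nat (int n - x\<^sup>2 - y\<^sup>2))" for x y :: int
  define P where "P = {(x::int, y::int). x\<^sup>2 + y\<^sup>2 < int n}"
  define R where "R = {(x::int, y::int). x\<^sup>2 + y\<^sup>2 = int n}"
  have finP: "finite P"
    unfolding P_def by (rule finite_subset[OF _ finite_two_square_reps[of "int n"]]) auto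
  have finR: "finite R"
    unfolding R_def by (rule finite_subset[OF _ finite_two_square_reps[of "int n"]]) auto
  have "(\<Sum>j<n. int (r2 j) * alt_sum (n - j))
      = (\<Sum>j<n. \<Sum>(x, y) \<in> {t \<in> P. (case t of (x, y) \<Rightarrow> nat (x\<^sup>2 + y\<^sup>2)) = j}. f x y)"
  proof (rule sum.cong)
    fix j assume j: "j \<in> {..<n}"
    have eq: "{t \<in> P. (case t of (x, y) \<Rightarrow> nat (x\<^sup>2 + y\<^sup>2)) = j} = {(x, y). int j = x\<^sup>2 + y\<^sup>2}"
      using j by (auto simp: P_def)
    have "(\<Sum>(x, y) \<in> {(x, y). int j = x\<^sup>2 + y\<^sup>2}. f x y)
        = (\<Sum>(x, y) \<in> {(x::int, y::int). int j = x\<^sup>2 + y\<^sup>2}. alt_sum (n - j))"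
    proof (rule sum.cong)
      fix t :: "int \<times> int" assume "t \<in> {(x, y). int j = x\<^sup>2 + y\<^sup>2}"
      then obtain x y where t: "t = (x, y)" and "int j = x\<^sup>2 + y\<^sup>2" by auto
      then have "nat (int n - x\<^sup>2 - y\<^sup>2) = n - j" by linarith
      then show "(case t of (x, y) \<Rightarrow> f x y) = (case t of (x, y) \<Rightarrow> alt_sum (n - j))"
        by (simp add: t f_def)
    qed simp
    also have "\<dots> = int (r2 j) * alt_sum (n - j)" by (simp add: r2_def case_prod_unfold)
    finally show "int (r2 j) * alt_sum (n - j)
        = (\<Sum>(x, y) \<in> {t \<in> P. (case t of (x, y) \<Rightarrow> nat (x\<^sup>2 + y\<^sup>2)) = j}. f x y)"
      unfolding eq ..
  qed simp
  also have "\<dots> = (\<Sum>(x, y) \<in> P. f x y)"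
    by (rule sum.group[OF finP]) (auto simp: P_def nat_less_iff)
  also have "P = Sigma {x. x\<^sup>2 < int n} (\<lambda>x. {y. y\<^sup>2 < int n - x\<^sup>2})"
    by (auto simp: P_def intro: le_less_trans[rotated])
  also have "(\<Sum>(x, y) \<in> \<dots>. f x y) = (\<Sum>x | x\<^sup>2 < int n. \<Sum>y | y\<^sup>2 < int n - x\<^sup>2. f x y)"
    by (rule sum.Sigma[symmetric]) (auto simp: finite_square_less)
  finally have "2 * (\<Sum>j<n. int (r2 j) * alt_sum (n - j))
      = (\<Sum>x | x\<^sup>2 < int n. 2 * (\<Sum>y | y\<^sup>2 < int n - x\<^sup>2. f x y))"
    by (simp add: sum_distrib_left)
  also have "\<dots> = (\<Sum>x | x\<^sup>2 < int n. \<Sum>y | y\<^sup>2 = int n - x\<^sup>2. y\<^sup>2)"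
  proof (rule sum.cong)
    fix x :: int assume "x \<in> {x. x\<^sup>2 < int n}"
    then show "2 * (\<Sum>y | y\<^sup>2 < int n - x\<^sup>2. f x y) = (\<Sum>y | y\<^sup>2 = int n - x\<^sup>2. y\<^sup>2)"
      using alt_sum_recurrence[of "nat (int n - x\<^sup>2)"] by (simp add: f_def)
  qed simp
  also have "\<dots> = (\<Sum>(x, y) \<in> Sigma {x. x\<^sup>2 < int n} (\<lambda>x. {y. y\<^sup>2 = int n - x\<^sup>2}). y\<^sup>2)"
  proof (rule sum.Sigma)
    show "\<forall>x\<in>{x. x\<^sup>2 < int n}. finite {y. y\<^sup>2 = int n - x\<^sup>2}"
      by (auto intro: finite_subset[OF _ finite_square_less[of "int n - _ + 1"]])
  qed (rule finite_square_less)
  also have "\<dots> = (\<Sum>(x, y) \<in> R. y\<^sup>2)"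
  \<comment> \<open>The circle points missed by x^2 < n have y = 0 and contribute nothing.\<close>
  proof (rule sum.mono_neutral_left[OF finR])
    have "y = 0" if "x\<^sup>2 + y\<^sup>2 = int n" "\<not> x\<^sup>2 < int n" for x y
      using that zero_less_power2[of y] by linarith
    then have "y = 0 \<or> x\<^sup>2 < int n" if "(x, y) \<in> R" for x y
      using that unfolding R_def by blast
    then show "\<forall>t \<in> R - Sigma {x. x\<^sup>2 < int n} (\<lambda>x. {y. y\<^sup>2 = int n - x\<^sup>2}). (case t of (x, y) \<Rightarrow> y\<^sup>2) = 0"
      by (fastforce simp: R_def)
  qed (auto simp: R_def)
  finally have half: "2 * (\<Sum>j<n. int (r2 j) * alt_sum (n - j)) = (\<Sum>(x, y) \<in> R. y\<^sup>2)" .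
  \<comment> \<open>By the symmetry of the circle, doubling replaces y^2 by x^2 + y^2, which is
    constantly n; this turns the factor 2 into 4.\<close>
  have "(\<Sum>(x, y) \<in> R. y\<^sup>2) = (\<Sum>(x, y) \<in> R. x\<^sup>2)"
    by (rule sum.reindex_bij_witness[of _ prod.swap prod.swap]) (auto simp: R_def)
  with half have "4 * (\<Sum>j<n. int (r2 j) * alt_sum (n - j)) = (\<Sum>(x, y) \<in> R. x\<^sup>2) + (\<Sum>(x, y) \<in> R. y\<^sup>2)"
    by simp
  also have "\<dots> = (\<Sum>t \<in> R. int n)"
    unfolding sum.distrib[symmetric] by (rule sum.cong) (auto simp: R_def)
  also have "\<dots> = int n * int (r2 n)"
  proof -
    have "R = {(x, y). int n = x\<^sup>2 + y\<^sup>2}" by (auto simp: R_def)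
    then show ?thesis by (simp add: r2_def)
  qed
  finally show ?thesis .
qed

section \<open>Parity and values of the divisor sum\<close>

lemma even_odd_codivisor_sum_even:
  assumes "even m"
  shows "even (odd_codivisor_sum m)"
  unfolding odd_codivisor_sum_def
proof (rule dvd_sum)
  fix d assume "d \<in> {d. d dvd m \<and> odd (m div d)}"
  then have "d * (m div d) = m" "odd (m div d)" by auto
  then show "even (int d)" using assms by (metis even_mult_iff even_of_nat)
qed

text \<open>The divisors d and m/d are distinct because m is not a square, and both are odd, so each
  pair has an even sum.\<close>

lemma even_odd_codivisor_sum_nonsquare:
  assumes "odd m" "\<nexists>k. m = k\<^sup>2"
  shows "even (odd_codivisor_sum m)"
proof -
  have "0 < m" using assms by (auto intro: Nat.gr0I)
  define S where "S = {d. d dvd m \<and> d * d < m}"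
  define L where "L = {d. d dvd m \<and> m < d * d}"
  have fin: "finite S" "finite L"
    using \<open>0 < m\<close> by (auto simp: S_def L_def intro: finite_subset[OF _ finite_divisors_nat])
  have odds: "odd d" "odd (m div d)" "d * (m div d) = m" if "d dvd m" for d
    using that assms(1) by (metis dvd_mult_div_cancel even_mult_iff)+
  have "d * d < m \<or> m < d * d" for d
    using assms(2) by (metis linorder_neqE_nat power2_eq_square)
  then have "{d. d dvd m \<and> odd (m div d)} = S \<union> L"
    using odds(2) by (auto simp: S_def L_def)
  then have "odd_codivisor_sum m = (\<Sum>d \<in> S \<union> L. int d)"
    by (simp add: odd_codivisor_sum_def)
  also have "\<dots> = (\<Sum>d\<in>S. int d) + (\<Sum>d\<in>L. int d)"
    by (rule sum.union_disjoint) (use fin in \<open>auto simp: S_def L_def\<close>)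
  also have "(\<Sum>d\<in>L. int d) = (\<Sum>d\<in>S. int (m div d))"
  proof (rule sum.reindex_bij_witness[of _ "\<lambda>d. m div d" "\<lambda>d. m div d"])
    \<comment> \<open>The squares of d and of m/d have product m^2, so one lies below m exactly when
      the other lies above; hence the complement exchanges \<open>S\<close> and
      \<open>L\<close>.\<close>
    have swap: "(m div d) * (m div d) * (d * d) = m * m" if "d dvd m" for d
      using odds(3)[OF that] by (metis mult.assoc mult.commute)
    show "m div d \<in> S" if "d \<in> L" for d
    proof -
      have "d dvd m" "m < d * d" using that by (auto simp: L_def)
      have "(m div d) * (m div d) < m"
      proof (rule ccontr)
        assume "\<not> ?thesis"
        then have "m * (d * d) \<le> (m div d) * (m div d) * (d * d)" by simp
        then have "m * (d * d) \<le> m * m" using swap[OF \<open>d dvd m\<close>] by simp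
        then show False using \<open>m < d * d\<close> \<open>0 < m\<close> by simp
      qed
      then show ?thesis using \<open>d dvd m\<close> by (auto simp: S_def)
    qed
    show "m div d \<in> L" if "d \<in> S" for d
    proof -
      have "d dvd m" "d * d < m" using that by (auto simp: S_def)
      have "m < (m div d) * (m div d)"
      proof (rule ccontr)
        assume "\<not> ?thesis"
        then have "(m div d) * (m div d) * (d * d) \<le> m * (d * d)" by simp
        then have "m * m \<le> m * (d * d)" using swap[OF \<open>d dvd m\<close>] by simp
        then show False using \<open>d * d < m\<close> \<open>0 < m\<close> by simp
      qed
      then show ?thesis using \<open>d dvd m\<close> by (auto simp: L_def)
    qed
  qed (use \<open>0 < m\<close> in \<open>auto simp: S_def L_def\<close>)
  also have "(\<Sum>d\<in>S. int d) + (\<Sum>d\<in>S. int (m div d)) = (\<Sum>d\<in>S. int d + int (m div d))"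
    by (simp add: sum.distrib)
  finally show ?thesis
    using odds(1,2) by (auto simp: S_def intro!: dvd_sum)
qed

text \<open>A divisor of 2m with odd codivisor must absorb the factor 2, and halving it leaves the
  codivisor unchanged.\<close>

lemma odd_codivisor_sum_double:
  assumes "0 < m"
  shows "odd_codivisor_sum (2 * m) = 2 * odd_codivisor_sum m"
proof -
  have "odd_codivisor_sum (2 * m) = (\<Sum>d | d dvd m \<and> odd (m div d). int (2 * d))"
    unfolding odd_codivisor_sum_def
  proof (rule sum.reindex_bij_witness[of _ "\<lambda>d. 2 * d" "\<lambda>d. d div 2"], goal_cases)
    case (1 d)
    then have "d * (2 * m div d) = 2 * m" "odd (2 * m div d)" by auto
    then have "even d" by (metis dvd_triv_left even_mult_iff)
    then show ?case by simp
  next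
    case (2 d)
    then have "d * (2 * m div d) = 2 * m" "odd (2 * m div d)" by auto
    then have "even d" by (metis dvd_triv_left even_mult_iff)
    then show ?case using 2 by (auto elim!: evenE)
  next
    case (5 d)
    then have "d * (2 * m div d) = 2 * m" "odd (2 * m div d)" by auto
    then have "even d" by (metis dvd_triv_left even_mult_iff)
    then show ?case by simp
  qed auto
  then show ?thesis by (simp add: odd_codivisor_sum_def sum_distrib_left)
qed

lemma odd_codivisor_sum_prime:
  assumes "prime p" "odd p"
  shows "odd_codivisor_sum p = int p + 1"
proof -
  have "p \<noteq> 1" "0 < p" using assms(1) by (auto simp: prime_gt_0_nat)
  then have "{d. d dvd p \<and> odd (p div d)} = {1, p}"
    using assms by (auto simp: prime_nat_iff)
  then show ?thesis using \<open>p \<noteq> 1\<close> by (simp add: odd_codivisor_sum_def)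
qed

section \<open>The weight of the theorem as a signed divisor sum\<close>

lemma sigma_star_of_nat:
  assumes "0 < m"
  shows "sigma_star (of_nat m) = odd_codivisor_sum m"
  using assms by (simp add: sigma_star_def odd_codivisor_sum_def)

text \<open>For m = 2k, doubling gives s(m) = 2 s(k), hence s(m) - 4 s(k) = -s(m). For odd m the
  half is not an integer, and \<open>sigma_star\<close> vanishes there.\<close>

lemma sigma_star_diff_half:
  assumes "0 < m"
  shows "sigma_star (of_nat m) - 4 * sigma_star (of_nat m / 2) = alt_sum m"
proof (cases "even m")
  case True
  then obtain k where k: "m = 2 * k" by blast
  then have "sigma_star (of_nat m / 2) = odd_codivisor_sum k"
    using assms sigma_star_of_nat[of k] by simp
  then show ?thesis
    using assms k by (simp add: sigma_star_of_nat odd_codivisor_sum_double alt_sum_def sg_def del: of_nat_mult)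
next
  case False
  have "(of_nat m / 2 :: rat) \<notin> \<nat>"
  proof
    assume "(of_nat m / 2 :: rat) \<in> \<nat>"
    then obtain k where "(of_nat m / 2 :: rat) = of_nat k" by (auto simp: Nats_def)
    then have "(of_nat m :: rat) = of_nat (2 * k)" by (simp add: field_simps)
    then have "m = 2 * k" using of_nat_eq_iff by blast
    with False show False by simp
  qed
  then have "sigma_star (of_nat m / 2) = 0" by (simp add: sigma_star_def)
  then show ?thesis using assms False by (simp add: sigma_star_of_nat alt_sum_def sg_def)
qed

section \<open>Primes as sums of two squares\<close>

text \<open>
  If $p$ is not a sum of two squares, then all $f(p - k^2)$ are even, and pairing $k$ with $-k$
  in their sum, which is $0$, gives $f(p) = p + 1 \equiv 0$ modulo $4$.
\<close>

lemma prime_sum_two_squares: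
  fixes p :: nat
  assumes "prime p" "[p = 1] (mod 4)"
  shows "\<exists>x y. int p = x\<^sup>2 + y\<^sup>2"
proof (rule ccontr)
  assume contr: "\<not> ?thesis"
  define f where "f k = alt_sum (nat (int p - k\<^sup>2))" for k
  have "p mod 4 = 1" using assms(2) by (simp add: cong_def)
  then have "odd p" by presburger
  have "0 < p" using assms(1) by (simp add: prime_gt_0_nat)
  have nonsq: "\<nexists>m. int p = m\<^sup>2"
  proof
    assume "\<exists>m. int p = m\<^sup>2"
    then obtain m where "int p = m\<^sup>2 + 0\<^sup>2" by auto
    then show False using contr by blast
  qed
  have even: "even (f k)" if "k\<^sup>2 < int p" for k
  proof -
    have "\<nexists>l. nat (int p - k\<^sup>2) = l\<^sup>2"
    proof
      assume "\<exists>l. nat (int p - k\<^sup>2) = l\<^sup>2"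
      then obtain l where "nat (int p - k\<^sup>2) = l\<^sup>2" by blast
      then have "int p - k\<^sup>2 = (int l)\<^sup>2" using that by (metis diff_gt_0_iff_gt int_nat_eq less_imp_le of_nat_power)
      then have "int p = k\<^sup>2 + (int l)\<^sup>2" by simp
      then show False using contr by blast
    qed
    then have "even (odd_codivisor_sum (nat (int p - k\<^sup>2)))"
      using even_odd_codivisor_sum_even even_odd_codivisor_sum_nonsquare by blast
    then show ?thesis by (simp add: f_def alt_sum_def)
  qed
  let ?N = "{k. k\<^sup>2 < int p \<and> k < 0}" and ?Q = "{k. k\<^sup>2 < int p \<and> 0 < k}"
  have fin: "finite ?N" "finite ?Q" by (auto intro: finite_subset[OF _ finite_square_less[of "int p"]])
  have "{k. k\<^sup>2 < int p} = insert 0 (?N \<union> ?Q)" using \<open>0 < p\<close> by auto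
  then have "(\<Sum>k | k\<^sup>2 < int p. f k) = sum f (insert 0 (?N \<union> ?Q))"
    by (rule arg_cong)
  also have "\<dots> = f 0 + sum f (?N \<union> ?Q)"
    by (rule sum.insert) (use fin in auto)
  also have "sum f (?N \<union> ?Q) = sum f ?N + sum f ?Q"
    by (rule sum.union_disjoint) (use fin in auto)
  also have "sum f ?N = sum f ?Q"
    by (rule sum.reindex_bij_witness[of _ uminus uminus]) (auto simp: f_def)
  also have "f 0 = int p + 1"
    using odd_codivisor_sum_prime[OF assms(1) \<open>odd p\<close>] \<open>odd p\<close> by (simp add: f_def alt_sum_def sg_def)
  finally have "int p + 1 + 2 * sum f ?Q = 0"
    using alt_sum_recurrence_nonsquare[OF nonsq] by (simp add: f_def)
  moreover have "even (sum f ?Q)" by (rule dvd_sum) (simp add: even)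
  ultimately show False using \<open>p mod 4 = 1\<close> by presburger
qed

text \<open>Euler's argument: p divides ad - bc or ad + bc. Writing p^2 as a sum of two squares by
  the Brahmagupta identity shows that this multiple of p is 0 or p in absolute value. Positivity
  then leaves ad = bc in the first case and ad + bc = p, hence ac = bd, in the second.\<close>

lemma prime_two_squares_unique:
  fixes p :: nat and a b c d :: int
  assumes "prime p" "a\<^sup>2 + b\<^sup>2 = int p" "c\<^sup>2 + d\<^sup>2 = int p" "0 < a" "0 < b" "0 < c" "0 < d"
  shows "a = c \<and> b = d \<or> a = d \<and> b = c"
proof -
  have p: "prime (int p)" using assms(1) by simp
  have prod: "(a\<^sup>2 + b\<^sup>2) * (c\<^sup>2 + d\<^sup>2) = (int p)\<^sup>2"
    unfolding assms(2,3) by (simp add: power2_eq_square)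
  have le: "u\<^sup>2 \<le> (int p)\<^sup>2 \<Longrightarrow> \<bar>u\<bar> \<le> int p" for u :: int
    using abs_le_square_iff[of u "int p"] by simp
  have small: "u = 0 \<or> \<bar>u\<bar> = int p" if "int p dvd u" "u\<^sup>2 \<le> (int p)\<^sup>2" for u
    using le[OF that(2)] zdvd_imp_le[of "int p" "\<bar>u\<bar>"] that(1) by fastforce
  have "(a * d - b * c) * (a * d + b * c) = a\<^sup>2 * (c\<^sup>2 + d\<^sup>2) - (a\<^sup>2 + b\<^sup>2) * c\<^sup>2"
    by (simp add: power2_eq_square algebra_simps)
  also have "\<dots> = int p * (a\<^sup>2 - c\<^sup>2)" unfolding assms(2,3) by (simp add: algebra_simps)
  finally have "int p dvd (a * d - b * c) * (a * d + b * c)" by simp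
  then consider "int p dvd a * d - b * c" | "int p dvd a * d + b * c"
    using p by (auto simp: prime_dvd_mult_iff)
  then show ?thesis
  proof cases
    case 1
    have eq: "(a * c + b * d)\<^sup>2 + (a * d - b * c)\<^sup>2 = (int p)\<^sup>2"
      unfolding prod[symmetric]
      by (simp add: power2_eq_square algebra_simps)
    have pos: "0 < a * c + b * d" using assms by (simp add: add_pos_pos)
    then have "0 < (a * c + b * d)\<^sup>2" by simp
    then have "\<bar>a * d - b * c\<bar> \<noteq> int p" using eq by (metis add_cancel_left_left less_irrefl power2_abs)
    moreover have "(a * d - b * c)\<^sup>2 \<le> (int p)\<^sup>2" using eq zero_le_power2[of "a * c + b * d"] by linarith
    ultimately have "a * d = b * c" using small[OF 1] by simp
    \<comment> \<open>Adding (ac)^2 lets p factor out of both sides: a^2 p = c^2 p.\<close>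
    then have "(a * c)\<^sup>2 + (a * d)\<^sup>2 = (a * c)\<^sup>2 + (b * c)\<^sup>2" by simp
    then have "a\<^sup>2 * (c\<^sup>2 + d\<^sup>2) = c\<^sup>2 * (a\<^sup>2 + b\<^sup>2)"
      by (simp add: power_mult_distrib algebra_simps)
    then have "a\<^sup>2 = c\<^sup>2" using assms(1-3) by (auto simp: prime_gt_0_nat)
    then have "a = c" using assms by (auto simp: power2_eq_iff)
    then have "b\<^sup>2 = d\<^sup>2" using assms(2,3) by simp
    then have "b = d" using \<open>0 < b\<close> \<open>0 < d\<close> by (auto simp: power2_eq_iff)
    with \<open>a = c\<close> show ?thesis by simp
  next
    case 2
    have eq: "(a * c - b * d)\<^sup>2 + (a * d + b * c)\<^sup>2 = (int p)\<^sup>2"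
      unfolding prod[symmetric]
      by (simp add: power2_eq_square algebra_simps)
    have pos: "0 < a * d + b * c" using assms by (simp add: add_pos_pos)
    have "(a * d + b * c)\<^sup>2 \<le> (int p)\<^sup>2" using eq zero_le_power2[of "a * c - b * d"] by linarith
    then have "a * d + b * c = int p" using small[OF 2] pos by simp
    then have "a * c = b * d" using eq by simp
    then have "(a * c)\<^sup>2 + (a * d)\<^sup>2 = (b * d)\<^sup>2 + (a * d)\<^sup>2" by simp
    then have "a\<^sup>2 * (c\<^sup>2 + d\<^sup>2) = d\<^sup>2 * (a\<^sup>2 + b\<^sup>2)"
      by (simp add: power_mult_distrib algebra_simps)
    then have "a\<^sup>2 = d\<^sup>2" using assms(1-3) by (auto simp: prime_gt_0_nat)
    then have "a = d" using assms by (auto simp: power2_eq_iff)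
    then have "b\<^sup>2 = c\<^sup>2" using assms(2,3) by simp
    then have "b = c" using \<open>0 < b\<close> \<open>0 < c\<close> by (auto simp: power2_eq_iff)
    with \<open>a = d\<close> show ?thesis by simp
  qed
qed

lemma prime_neq_square_int:
  fixes p :: nat
  assumes "prime p"
  shows "int p \<noteq> x\<^sup>2"
proof
  assume "int p = x\<^sup>2"
  then have "int p = int ((nat \<bar>x\<bar>)\<^sup>2)" by simp
  then have "p = (nat \<bar>x\<bar>)\<^sup>2" using of_nat_eq_iff by blast
  then show False using assms by (simp add: prime_power_iff)
qed

text \<open>One representation yields eight by signs and order. They are distinct because p is
  neither a square (no zero coordinate) nor even (no equal coordinates), and uniqueness shows that
  there are no others.\<close>

lemma r2_prime_1_mod_4:
  assumes "prime p" "[p = 1] (mod 4)"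
  shows "r2 p = 8"
proof -
  obtain x y where xy: "int p = x\<^sup>2 + y\<^sup>2" using prime_sum_two_squares[OF assms] by blast
  define a b where "a = \<bar>x\<bar>" and "b = \<bar>y\<bar>"
  have ab: "a\<^sup>2 + b\<^sup>2 = int p" using xy by (simp add: a_def b_def)
  have nz: "u \<noteq> 0 \<and> v \<noteq> 0" if "u\<^sup>2 + v\<^sup>2 = int p" for u v
    using that prime_neq_square_int[OF assms(1), of u] prime_neq_square_int[OF assms(1), of v] by auto
  then have "0 < a" "0 < b" using ab by (auto simp: a_def b_def)
  have "a \<noteq> b"
  proof
    assume "a = b"
    then have "even (int p)" using ab by (simp flip: ab)
    then show False using assms(2) by (simp add: cong_def) presburger
  qed
  have "{(x1, x2). int p = x1\<^sup>2 + x2\<^sup>2}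
      = {(a, b), (a, - b), (- a, b), (- a, - b), (b, a), (b, - a), (- b, a), (- b, - a)}" (is "?L = ?R")
  proof
    show "?L \<subseteq> ?R"
    proof
      fix t assume "t \<in> ?L"
      then obtain u v where t: "t = (u, v)" and uv: "int p = u\<^sup>2 + v\<^sup>2" by blast
      then have "a = \<bar>u\<bar> \<and> b = \<bar>v\<bar> \<or> a = \<bar>v\<bar> \<and> b = \<bar>u\<bar>"
        using prime_two_squares_unique[OF assms(1) ab, of "\<bar>u\<bar>" "\<bar>v\<bar>"] nz[of u v] \<open>0 < a\<close> \<open>0 < b\<close> by auto
      moreover have "u = \<bar>u\<bar> \<or> u = - \<bar>u\<bar>" "v = \<bar>v\<bar> \<or> v = - \<bar>v\<bar>" by linarith+
      ultimately show "t \<in> ?R" unfolding t by (elim disjE conjE) simp_all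
    qed
    show "?R \<subseteq> ?L" using ab by auto
  qed
  then show ?thesis
    using \<open>0 < a\<close> \<open>0 < b\<close> \<open>a \<noteq> b\<close> unfolding r2_def by (auto simp: card_insert_if)
qed

lemma r2_3_mod_4:
  assumes "[p = 3] (mod 4)"
  shows "r2 p = 0"
proof -
  have sq: "x\<^sup>2 mod 4 = 0 \<or> x\<^sup>2 mod 4 = 1" for x :: int
  proof (cases "even x")
    case True
    then show ?thesis by (auto elim!: evenE simp: power2_eq_square)
  next
    case False
    then obtain k where "x = 2 * k + 1" by (elim oddE)
    then have "x\<^sup>2 = 4 * (k\<^sup>2 + k) + 1" by (simp add: power2_eq_square algebra_simps)
    then show ?thesis by presburger
  qed
  have "p mod 4 = 3" using assms by (simp add: cong_def)
  then have "int p mod 4 = 3" by presburger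
  moreover have "(x\<^sup>2 + y\<^sup>2) mod 4 \<noteq> 3" for x y :: int
    by (subst mod_add_eq[symmetric]) (use sq[of x] sq[of y] in \<open>elim disjE; simp\<close>)
  ultimately have "int p \<noteq> x\<^sup>2 + y\<^sup>2" for x y by metis
  then have "{(x1, x2). int p = x1\<^sup>2 + x2\<^sup>2} = {}" by auto
  then show ?thesis by (simp add: r2_def)
qed

section \<open>The convolution at a prime\<close>

lemma r2_0: "r2 0 = 1"
proof -
  have "{(x1::int, x2::int). int 0 = x1\<^sup>2 + x2\<^sup>2} = {(0, 0)}"
    using sum_power2_eq_zero_iff[where 'a = int] by auto
  then show ?thesis by (simp add: r2_def)
qed

theorem theorem3p3:
  fixes p :: nat
  assumes "prime p"
  shows "([p = 1] (mod 4) \<longrightarrow>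
      (\<Sum>j = 1..p - 1. int (r2 j) *
        (sigma_star (of_nat p - of_nat j) - 4 * sigma_star ((of_nat p - of_nat j) / 2)))
      = int p - 1) \<and>
    ([p = 3] (mod 4) \<longrightarrow>
      (\<Sum>j = 1..p - 1. int (r2 j) *
        (sigma_star (of_nat p - of_nat j) - 4 * sigma_star ((of_nat p - of_nat j) / 2)))
      = - int p - 1)"
proof -
  let ?S = "\<Sum>j = 1..p - 1. int (r2 j) *
        (sigma_star (of_nat p - of_nat j) - 4 * sigma_star ((of_nat p - of_nat j) / 2))"
  have "0 < p" using assms by (simp add: prime_gt_0_nat)
  have "?S = (\<Sum>j = 1..p - 1. int (r2 j) * alt_sum (p - j))"
  proof (rule sum.cong)
    fix j assume "j \<in> {1..p - 1}"
    then have "j < p" by auto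
    then show "int (r2 j) *
        (sigma_star (of_nat p - of_nat j) - 4 * sigma_star ((of_nat p - of_nat j) / 2))
        = int (r2 j) * alt_sum (p - j)"
      using sigma_star_diff_half[of "p - j"] by (simp add: of_nat_diff)
  qed simp
  \<comment> \<open>The convolution starts at j = 0, the sum of the theorem at j = 1; the difference
    is the single term \<open>alt_sum p\<close>.\<close>
  moreover have "{..<p} = insert 0 {1..p - 1}" using \<open>0 < p\<close> by auto
  ultimately have "(\<Sum>j<p. int (r2 j) * alt_sum (p - j)) = alt_sum p + ?S"
    by (simp add: r2_0)
  then have main: "4 * (alt_sum p + ?S) = int p * int (r2 p)"
    using r2_alt_sum_convolution[of p] by simp
  have alt: "alt_sum p = int p + 1" if "odd p"
    using that odd_codivisor_sum_prime[OF assms that] by (simp add: alt_sum_def sg_def)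
  have "odd p" if "p mod 4 = 1 \<or> p mod 4 = 3" using that by presburger
  then have odd: "odd p" if "[p = 1] (mod 4) \<or> [p = 3] (mod 4)"
    using that by (simp add: cong_def)
  \<comment> \<open>As \<open>alt_sum p\<close> is p + 1, the value \<open>r2 p = 8\<close> gives p
    + 1 + S = 2p, and \<open>r2 p = 0\<close> gives p + 1 + S = 0, where S is
    \<open>?S\<close>.\<close>
  show ?thesis
  proof (intro conjI impI)
    assume p: "[p = 1] (mod 4)"
    show "?S = int p - 1"
      using main alt odd p unfolding r2_prime_1_mod_4[OF assms p] by auto
  next
    assume p: "[p = 3] (mod 4)"
    show "?S = - int p - 1"
      using main alt odd p unfolding r2_3_mod_4[OF p] by auto
  qed
qed

end
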